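(* Let $G$ be a group of prime order $p$, so $G\cong\mathbb{Z}_p$. Then for every ordering $A$ of the elements of $G$, $$\operatorname{Stab}(P(G,A))=\{\mu_0,\dots,\mu_{p-1}\},$$ so $|\operatorname{Stab}(P(G,A))|=p$ and the stable lattice $L(P(G,A))$ is a $p$-element chain.
   Context: A strict complete profile consists of equally many men and women, each with a strict total order over all participants of the opposite side. A matching is a bijection $\mu$ from men to women. A pair $(m,w)$ blocks $\mu$ if $m$ prefers $w$ to $\mu(m)$ and $w$ prefers $m$ to $\mu^{-1}(w)$; $\mu$ is stable if no pair blocks it. $\operatorname{Stab}(S)$ is the set of stable matchings of a profile $S$; the stable lattice $L(S)$ is $\operatorname{Stab}(S)$ with the men-dominance order: $\mu\succeq_M\nu$ if every man weakly prefers his partner in $\mu$ to his partner in $\nu$. For a finite group $G$ of order $n$ and an ordering $A=(a_0,\dots,a_{n-1})$ of $G$ (a tuple listing each element exactly once), the regular anti-phase template $P(G,A)$ is the profile with men $m_g$ and women $w_g$ indexed by $g\in G$ and lists $$m_g:\ w_{ga_0}\succ w_{ga_1}\succ\cdots\succ w_{ga_{n-1}},\qquad w_h:\ m_{ha_{n-1}^{-1}}\succ m_{ha_{n-2}^{-1}}\succ\cdots\succ m_{ha_0^{-1}}.$$ For $t=0,\dots,n-1$ the canonical matching $\mu_t$ is $\mu_t(m_g)=w_{ga_t}$ for all $g\in G$. *)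

theory Defs
  imports "HOL-Algebra.Elementary_Groups" "HOL-Algebra.Lattice"
    "HOL-Computational_Algebra.Primes" "HOL-Library.FuncSet"
begin

text \<open>
  A strict total order over the finite opposite side is given as a preference list,
  most preferred participant first.
\<close>

record ('m, 'w) profile =
  men :: "'m set"
  women :: "'w set"
  man_list :: "'m \<Rightarrow> 'w list"
  woman_list :: "'w \<Rightarrow> 'm list"

definition is_ranking :: "'x set \<Rightarrow> 'x list \<Rightarrow> bool" where
  "is_ranking X xs \<longleftrightarrow> distinct xs \<and> set xs = X"

definition strict_complete_profile :: "('m, 'w) profile \<Rightarrow> bool" where
  "strict_complete_profile S \<longleftrightarrow>
     finite (men S) \<and> finite (women S) \<and> card (men S) = card (women S) \<and>
     (\<forall>m\<in>men S. is_ranking (women S) (man_list S m)) \<and>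
     (\<forall>w\<in>women S. is_ranking (men S) (woman_list S w))"

definition before :: "'x list \<Rightarrow> 'x \<Rightarrow> 'x \<Rightarrow> bool" where
  "before xs x y \<longleftrightarrow> (\<exists>i j. i < j \<and> j < length xs \<and> xs ! i = x \<and> xs ! j = y)"

definition man_prefers :: "('m, 'w) profile \<Rightarrow> 'm \<Rightarrow> 'w \<Rightarrow> 'w \<Rightarrow> bool" where
  "man_prefers S m w w' \<longleftrightarrow> before (man_list S m) w w'"

definition woman_prefers :: "('m, 'w) profile \<Rightarrow> 'w \<Rightarrow> 'm \<Rightarrow> 'm \<Rightarrow> bool" where
  "woman_prefers S w m m' \<longleftrightarrow> before (woman_list S w) m m'"

text \<open>
  Matchings are extensional (undefined outside the set of men), so that equality of HOL
  functions is equality of matchings and sets of matchings have the intended cardinality.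
\<close>

definition matchings :: "('m, 'w) profile \<Rightarrow> ('m \<Rightarrow> 'w) set" where
  "matchings S = {\<mu> \<in> extensional (men S). bij_betw \<mu> (men S) (women S)}"

definition blocks :: "('m, 'w) profile \<Rightarrow> ('m \<Rightarrow> 'w) \<Rightarrow> 'm \<Rightarrow> 'w \<Rightarrow> bool" where
  "blocks S \<mu> m w \<longleftrightarrow>
     man_prefers S m w (\<mu> m) \<and> woman_prefers S w m (inv_into (men S) \<mu> w)"

definition Stab :: "('m, 'w) profile \<Rightarrow> ('m \<Rightarrow> 'w) set" where
  "Stab S = {\<mu> \<in> matchings S. \<not> (\<exists>m\<in>men S. \<exists>w\<in>women S. blocks S \<mu> m w)}"

definition men_dominates :: "('m, 'w) profile \<Rightarrow> ('m \<Rightarrow> 'w) \<Rightarrow> ('m \<Rightarrow> 'w) \<Rightarrow> bool" where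
  "men_dominates S \<mu> \<nu> \<longleftrightarrow> (\<forall>m\<in>men S. \<mu> m = \<nu> m \<or> man_prefers S m (\<mu> m) (\<nu> m))"

text \<open>The larger element of the stable lattice is the one that is better for the men.\<close>

definition stable_lattice :: "('m, 'w) profile \<Rightarrow> ('m \<Rightarrow> 'w) gorder" where
  "stable_lattice S =
     \<lparr>carrier = Stab S, eq = (=), le = (\<lambda>\<nu> \<mu>. men_dominates S \<mu> \<nu>)\<rparr>"

text \<open>
  The element \<open>g\<close> of the group serves both as the man $m_g$ and as the woman $w_g$;
  the two sides are kept apart by the fields of the profile.
  An ordering of the group is a list \<open>A\<close> with \<^prop>\<open>is_ranking (carrier G) A\<close>.
\<close>

definition template :: "('a, 'b) monoid_scheme \<Rightarrow> 'a list \<Rightarrow> ('a, 'a) profile" where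
  "template G A =
     \<lparr>men = carrier G, women = carrier G,
      man_list = (\<lambda>g. map (\<lambda>a. g \<otimes>\<^bsub>G\<^esub> a) A),
      woman_list = (\<lambda>h. map (\<lambda>a. h \<otimes>\<^bsub>G\<^esub> inv\<^bsub>G\<^esub> a) (rev A))\<rparr>"

definition canonical_matching ::
  "('a, 'b) monoid_scheme \<Rightarrow> 'a list \<Rightarrow> nat \<Rightarrow> 'a \<Rightarrow> 'a" where
  "canonical_matching G A t = (\<lambda>g\<in>carrier G. g \<otimes>\<^bsub>G\<^esub> A ! t)"

lemma (in group) strict_complete_profile_template:
  assumes A: "is_ranking (carrier G) A"
  shows "strict_complete_profile (template G A)"
proof -
  have fin: "finite (carrier G)"
    using A by (metis is_ranking_def List.finite_set)
  have men: "is_ranking (carrier G) (map (\<lambda>a. g \<otimes> a) A)" if g: "g \<in> carrier G" for g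
  proof -
    have "inj_on (\<lambda>a. g \<otimes> a) (carrier G)"
      using g by (auto intro!: inj_onI)
    moreover have "(\<lambda>a. g \<otimes> a) ` carrier G = carrier G"
      using g by (rule surj_const_mult)
    ultimately show ?thesis
      using A by (simp add: is_ranking_def distinct_map)
  qed
  have women: "is_ranking (carrier G) (map (\<lambda>a. h \<otimes> inv a) (rev A))"
    if h: "h \<in> carrier G" for h
  proof -
    have inj: "inj_on (\<lambda>a. h \<otimes> inv a) (carrier G)"
      using h by (intro inj_onI) (metis inv_closed inv_inv Units_eq Units_l_cancel)
    moreover have "(\<lambda>a. h \<otimes> inv a) ` carrier G = carrier G"
      using h by (intro endo_inj_surj[OF fin _ inj]) auto
    ultimately show ?thesis
      using A by (simp add: is_ranking_def distinct_map)
  qed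
  show ?thesis
    using fin men women by (simp add: strict_complete_profile_def template_def)
qed

end

theory Submission
  imports Defs "HOL-Algebra.Multiplicative_Group"
begin

text \<open>
  For a matching \<open>\<mu>\<close> write \<open>\<mu> g = g a\<^bsub>t(g)\<^esub>\<close>. Since a woman ranks her partner in the opposite
  direction, \<open>\<mu>\<close> is stable iff no \<open>g\<close> and \<open>s\<close> satisfy \<open>t(g') < s < t(g)\<close>, where \<open>g'\<close> is the
  partner of \<open>g a\<^sub>s\<close>. For the superlevel set \<open>M\<^sub>s = {g. s \<le> t(g)}\<close>, stability gives
  \<open>M\<^sub>s a\<^sub>s \<subseteq> \<mu>(M\<^sub>s)\<close>, and likewise \<open>M\<^bsub>s+1\<^esub> a\<^sub>s \<subseteq> \<mu>(M\<^bsub>s+1\<^esub>)\<close>; both inclusions are equalities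
  by counting. Hence \<open>M\<^bsub>s+1\<^esub> a\<^sub>s = M\<^bsub>s+1\<^esub> a\<^bsub>s+1\<^esub>\<close>, so \<open>M\<^bsub>s+1\<^esub>\<close> is invariant under right
  multiplication by a nontrivial element. In a group of prime order such a set is empty or
  everything, so \<open>t\<close> is constant.
\<close>

section \<open>Positions in preference lists\<close>

lemma before_nth_iff:
  assumes "distinct xs" "i < length xs" "j < length xs"
  shows "before xs (xs ! i) (xs ! j) \<longleftrightarrow> i < j"
proof
  assume "before xs (xs ! i) (xs ! j)"
  then obtain k l where kl: "k < l" "l < length xs" "xs ! k = xs ! i" "xs ! l = xs ! j"
    unfolding before_def by blast
  then have "k = i" "l = j"
    using assms by (simp_all add: nth_eq_iff_index_eq)
  with kl show "i < j" by simp
qed (use assms in \<open>auto simp: before_def\<close>)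

lemma before_rev_iff: "before (rev xs) x y \<longleftrightarrow> before xs y x"
proof -
  \<comment> \<open>Since \<open>rev\<close> is an involution, this implication, applied to
    \<open>rev xs\<close> and to \<open>xs\<close>, gives both directions.\<close>
  have imp: "before (rev zs) x y" if yx: "before zs y x" for zs :: "'a list" and x y
  proof -
    obtain i j where ij: "i < j" "j < length zs" "zs ! i = y" "zs ! j = x"
      using yx by (auto simp: before_def)
    show ?thesis
      unfolding before_def
    proof (intro exI conjI)
      show "length zs - Suc j < length zs - Suc i" "length zs - Suc i < length (rev zs)"
        using ij(1,2) by simp_all
      show "rev zs ! (length zs - Suc j) = x" "rev zs ! (length zs - Suc i) = y"
        using ij by (simp_all add: rev_nth)
    qed
  qed
  show ?thesis
    using imp[of "rev xs" x y] imp[of xs y x] by auto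
qed

section \<open>Groups of prime order\<close>

lemma (in group) prime_order_generate:
  assumes p: "prime (order G)" and c: "c \<in> carrier G" "c \<noteq> \<one>"
  shows "generate G {c} = carrier G"
proof -
  have sub: "subgroup (generate G {c}) G"
    using c by (intro generate_is_subgroup) auto
  \<comment> \<open>\<open>card\<close> is 0 on infinite sets, and 0 is not prime.\<close>
  have fin: "finite (carrier G)"
    using p by (metis card.infinite not_prime_0 order_def)
  have "card (generate G {c}) dvd order G"
    using lagrange[OF sub] by (metis dvd_triv_right)
  moreover have "card (generate G {c}) \<noteq> 1"
  proof
    assume "card (generate G {c}) = 1"
    moreover have "\<one> \<in> generate G {c}" "c \<in> generate G {c}"
      by (auto intro: generate.intros)
    ultimately show False
      using c(2) by (metis card_1_singletonE singletonD)
  qed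
  ultimately have "card (generate G {c}) = card (carrier G)"
    using p by (auto simp: prime_nat_iff order_def)
  with fin sub show ?thesis
    using card_subset_eq subgroup.subset by blast
qed

text \<open>A nontrivial \<open>c\<close> generates the group, so taking powers of \<open>c\<close>
  maps the residues onto it; injectivity follows by counting.\<close>

lemma (in group) prime_order_iso_integer_mod_group:
  assumes p: "prime (order G)"
  shows "G \<cong> integer_mod_group (order G)"
proof -
  let ?p = "order G" and ?Z = "integer_mod_group (order G)"
  have "1 < card (carrier G)"
    using p by (simp add: prime_nat_iff order_def)
  then have "\<not> carrier G \<subseteq> {\<one>}"
    using card_mono[of "{\<one>}" "carrier G"] by fastforce
  then obtain c where c: "c \<in> carrier G" "c \<noteq> \<one>"
    by blast
  \<comment> \<open>Exponents matter only modulo the order. This makes the power map a homomorphism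
    on residues and lets the residues reach every power.\<close>
  have pow: "c [^] (k mod int ?p) = c [^] k" for k :: int
  proof -
    have "k = int ?p * (k div int ?p) + k mod int ?p"
      by simp
    then have "c [^] k = c [^] (int ?p * (k div int ?p)) \<otimes> c [^] (k mod int ?p)"
      using c by (metis int_pow_mult)
    also have "c [^] (int ?p * (k div int ?p)) = \<one>"
      using c by (metis int_pow_int int_pow_one int_pow_pow pow_order_eq_1)
    finally show ?thesis
      using c by simp
  qed
  have carr: "carrier ?Z = {0..<int ?p}"
    using p by (auto simp: carrier_integer_mod_group)
  have img: "(\<lambda>k::int. c [^] k) ` carrier ?Z = carrier G"
  proof
    show "(\<lambda>k::int. c [^] k) ` carrier ?Z \<subseteq> carrier G"
      using c by auto
    show "carrier G \<subseteq> (\<lambda>k::int. c [^] k) ` carrier ?Z"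
    proof
      fix x assume "x \<in> carrier G"
      then obtain k :: int where "x = c [^] k"
        using prime_order_generate[OF p c] generate_pow[OF c(1)] by auto
      then have "x = c [^] (k mod int ?p)"
        using pow by simp
      moreover have "k mod int ?p \<in> carrier ?Z"
        using p by (simp add: carr prime_gt_0_nat)
      ultimately show "x \<in> (\<lambda>k::int. c [^] k) ` carrier ?Z"
        by blast
    qed
  qed
  have "inj_on (\<lambda>k::int. c [^] k) (carrier ?Z)"
    by (rule eq_card_imp_inj_on) (simp_all only: img, simp_all add: carr flip: order_def)
  moreover have "(\<lambda>k::int. c [^] k) \<in> hom ?Z G"
    using c by (auto simp: hom_def pow int_pow_mult)
  ultimately have "(\<lambda>k::int. c [^] k) \<in> iso ?Z G"
    using img by (simp add: iso_def bij_betw_def)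
  then have "?Z \<cong> G"
    by (auto simp: is_iso_def)
  then show ?thesis
    by (rule group.iso_sym[OF group_integer_mod_group])
qed

text \<open>The elements whose right translation fixes \<open>M\<close> form a subgroup. It contains
  \<open>c\<close>, hence is the whole group, and translations carry a point of \<open>M\<close> to
  any other point.\<close>

lemma (in group) prime_order_r_coset_fixed:
  assumes p: "prime (order G)" and c: "c \<in> carrier G" "c \<noteq> \<one>"
    and M: "M \<subseteq> carrier G" "M \<noteq> {}" "M #> c = M"
  shows "M = carrier G"
proof -
  have fixed: "M #> x = M" if "x \<in> generate G {c}" for x
    using that
  proof (induction rule: generate.induct)
    case one
    then show ?case using M by simp
  next
    case (incl h)
    then show ?case using M by simp
  next
    case (inv h)
    then have "M #> inv h = (M #> c) #> inv c"
      using M by simp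
    also have "\<dots> = M"
      using M(1) c(1) by (subst coset_mult_assoc) simp_all
    finally show ?case .
  next
    case (eng h1 h2)
    then have "h1 \<in> carrier G" "h2 \<in> carrier G"
      using prime_order_generate[OF p c] by simp_all
    with eng M show ?case
      by (metis coset_mult_assoc)
  qed
  obtain g where g: "g \<in> M" "g \<in> carrier G"
    using M by blast
  have "x \<in> M" if x: "x \<in> carrier G" for x
  proof -
    have "g \<otimes> (inv g \<otimes> x) \<in> M #> (inv g \<otimes> x)"
      using g by (auto simp: r_coset_def)
    moreover have "g \<otimes> (inv g \<otimes> x) = x"
      using g x by (simp add: m_assoc[symmetric])
    ultimately show ?thesis
      using fixed prime_order_generate[OF p c] g x by simp
  qed
  with M show ?thesis by blast
qed

section \<open>Indices of couples in the template\<close>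

locale group_ordering = group +
  fixes A :: "'a list"
  assumes ranking: "is_ranking (carrier G) A"
begin

lemma distinct_ordering: "distinct A"
  and set_ordering: "set A = carrier G"
  using ranking by (auto simp: is_ranking_def)

lemma length_ordering: "length A = order G"
  using distinct_ordering set_ordering by (metis distinct_card order_def)

lemma finite_group: "finite (carrier G)"
  using set_ordering by (metis List.finite_set)

lemma nth_ordering_closed [simp]: "i < order G \<Longrightarrow> A ! i \<in> carrier G"
  using length_ordering set_ordering by (metis nth_mem)

lemma nth_ordering_eq_iff:
  "i < order G \<Longrightarrow> j < order G \<Longrightarrow> A ! i = A ! j \<longleftrightarrow> i = j"
  using nth_eq_iff_index_eq[OF distinct_ordering] length_ordering by auto

lemma men_template [simp]: "men (template G A) = carrier G"
  and women_template [simp]: "women (template G A) = carrier G"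
  by (simp_all add: template_def)

text \<open>Lets a matching be encoded by one index per man: \<open>i\<close> is the position of
  \<open>inv g \<otimes> h\<close> in \<open>A\<close>.\<close>

lemma ex_rank:
  assumes "g \<in> carrier G" "h \<in> carrier G"
  obtains i where "i < order G" "h = g \<otimes> A ! i"
proof -
  have "inv g \<otimes> h \<in> set A"
    using assms set_ordering by simp
  then obtain i where "i < order G" "A ! i = inv g \<otimes> h"
    using length_ordering by (metis in_set_conv_nth)
  then show ?thesis
    using that assms by (simp add: m_assoc[symmetric])
qed

lemma man_prefers_template_iff:
  assumes g: "g \<in> carrier G" and ij: "i < order G" "j < order G"
  shows "man_prefers (template G A) g (g \<otimes> A ! i) (g \<otimes> A ! j) \<longleftrightarrow> i < j"
proof -
  have "distinct (man_list (template G A) g)"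
    using strict_complete_profile_template[OF ranking] g
    by (simp add: strict_complete_profile_def is_ranking_def)
  from before_nth_iff[OF this, of i j] ij show ?thesis
    by (simp add: man_prefers_def template_def length_ordering)
qed

text \<open>Solving \<open>h = g \<otimes> A ! i\<close> for the man gives
  \<open>h \<otimes> inv (A ! i)\<close>: a couple has the same index on both sides, but women read
  the indices from the end.\<close>

lemma woman_prefers_template_iff:
  assumes g: "g \<in> carrier G" "g' \<in> carrier G" and ij: "i < order G" "j < order G"
    and h: "h = g \<otimes> A ! i" "h = g' \<otimes> A ! j"
  shows "woman_prefers (template G A) h g g' \<longleftrightarrow> j < i"
proof -
  \<comment> \<open>\<open>?L\<close> runs from the last choice of \<open>h\<close> to the first, so
    positions in it are indices of \<open>A\<close>.\<close>
  let ?L = "map (\<lambda>a. h \<otimes> inv a) A"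
  have hc: "h \<in> carrier G"
    using g ij h by simp
  have list: "woman_list (template G A) h = rev ?L"
    by (simp add: template_def rev_map)
  have "distinct (rev ?L)"
    using strict_complete_profile_template[OF ranking] hc
    by (simp add: strict_complete_profile_def is_ranking_def flip: list)
  then have dist: "distinct ?L"
    by (simp only: distinct_rev)
  have nth: "?L ! i = g" "?L ! j = g'"
    using g ij h by (simp_all add: length_ordering inv_solve_right')
  show ?thesis
    using before_nth_iff[OF dist, of j i] ij
    unfolding woman_prefers_def list before_rev_iff nth by (simp add: length_ordering)
qed

section \<open>Blocking pairs and canonical matchings\<close>

lemma canonical_matching_matching:
  assumes "t < order G"
  shows "canonical_matching G A t \<in> matchings (template G A)"
proof -
  have inj: "inj_on (\<lambda>g. g \<otimes> A ! t) (carrier G)"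
    using assms by (auto intro!: inj_onI)
  moreover have "(\<lambda>g. g \<otimes> A ! t) ` carrier G = carrier G"
    using assms by (intro endo_inj_surj[OF finite_group _ inj]) auto
  ultimately have "bij_betw (canonical_matching G A t) (carrier G) (carrier G)"
    unfolding canonical_matching_def by (subst bij_betw_restrict_eq) (simp add: bij_betw_def)
  then show ?thesis
    by (simp add: matchings_def canonical_matching_def)
qed

text \<open>By injectivity \<open>g'\<close> is the current partner of the woman in question. The
  man gains by a smaller index and she by a larger one.\<close>

lemma blocks_template_iff:
  assumes \<mu>: "\<mu> \<in> matchings (template G A)"
    and g: "g \<in> carrier G" "g' \<in> carrier G"
    and ijs: "i < order G" "j < order G" "s < order G"
    and eq: "\<mu> g = g \<otimes> A ! i" "\<mu> g' = g' \<otimes> A ! j" "\<mu> g' = g \<otimes> A ! s"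
  shows "blocks (template G A) \<mu> g (g \<otimes> A ! s) \<longleftrightarrow> j < s \<and> s < i"
proof -
  have "inj_on \<mu> (carrier G)"
    using \<mu> by (auto simp: matchings_def bij_betw_def)
  then have "inv_into (carrier G) \<mu> (g \<otimes> A ! s) = g'"
    using g eq by (metis inv_into_f_f)
  then show ?thesis
    unfolding blocks_def
    using man_prefers_template_iff[of g s i] woman_prefers_template_iff[of g g' s j "\<mu> g'"] g ijs eq
    by auto
qed

text \<open>All couples share the index \<open>t\<close>, so no index lies strictly between those of
  two couples.\<close>

lemma canonical_matching_stable:
  assumes t: "t < order G"
  shows "canonical_matching G A t \<in> Stab (template G A)"
proof -
  let ?\<mu> = "canonical_matching G A t"
  note \<mu> = canonical_matching_matching[OF t]
  have val: "?\<mu> g = g \<otimes> A ! t" if "g \<in> carrier G" for g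
    using that by (simp add: canonical_matching_def)
  have "\<not> blocks (template G A) ?\<mu> g h" if g: "g \<in> carrier G" and h: "h \<in> carrier G" for g h
  proof -
    obtain s where s: "s < order G" "h = g \<otimes> A ! s"
      using ex_rank g h by blast
    have "h \<in> ?\<mu> ` carrier G"
      using \<mu> h by (simp add: matchings_def bij_betw_def)
    then obtain g' where g': "g' \<in> carrier G" "?\<mu> g' = h"
      by blast
    have "blocks (template G A) ?\<mu> g (g \<otimes> A ! s) \<longleftrightarrow> t < s \<and> s < t"
      using g' s val[OF g] val[OF g'(1)]
      by (intro blocks_template_iff[OF \<mu> g g'(1) t t s(1)]) simp_all
    then show ?thesis
      using s by simp
  qed
  with \<mu> show ?thesis
    by (auto simp: Stab_def)
qed

lemma inj_canonical_matching: "inj_on (canonical_matching G A) {..<order G}"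
proof (rule inj_onI)
  fix s t assume st: "s \<in> {..<order G}" "t \<in> {..<order G}"
    and "canonical_matching G A s = canonical_matching G A t"
  \<comment> \<open>At the identity the matchings return the entries \<open>A ! s\<close> and
    \<open>A ! t\<close> themselves.\<close>
  then have "canonical_matching G A s \<one> = canonical_matching G A t \<one>"
    by simp
  then show "s = t"
    using st by (simp add: canonical_matching_def nth_ordering_eq_iff)
qed

lemma men_dominates_canonical_iff:
  assumes "s < order G" "t < order G"
  shows "men_dominates (template G A) (canonical_matching G A s) (canonical_matching G A t)
    \<longleftrightarrow> s \<le> t"
proof -
  have "(g \<otimes> A ! s = g \<otimes> A ! t \<or> man_prefers (template G A) g (g \<otimes> A ! s) (g \<otimes> A ! t))
      \<longleftrightarrow> s \<le> t" if "g \<in> carrier G" for g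
    using that assms man_prefers_template_iff[of g s t] nth_ordering_eq_iff[of s t] by auto
  then show ?thesis
    \<comment> \<open>All men make the same comparison; \<open>\<one>\<close> provides one, so the
      quantifier over men is not vacuous.\<close>
    using one_closed by (auto simp: men_dominates_def canonical_matching_def)
qed

section \<open>Superlevel sets of a stable matching\<close>

lemma stable_superlevel_shift:
  assumes \<mu>: "\<mu> \<in> Stab (template G A)"
    and t: "\<And>g. g \<in> carrier G \<Longrightarrow> t g < order G"
    and val: "\<And>g. g \<in> carrier G \<Longrightarrow> \<mu> g = g \<otimes> A ! t g"
    and s: "Suc s < order G"
  defines "M \<equiv> {g \<in> carrier G. Suc s \<le> t g}"
  shows "M #> A ! s = M #> A ! Suc s"
proof -
  have match: "\<mu> \<in> matchings (template G A)"
    and stable: "\<And>g h. g \<in> carrier G \<Longrightarrow> h \<in> carrier G \<Longrightarrow> \<not> blocks (template G A) \<mu> g h"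
    using \<mu> by (auto simp: Stab_def)
  have inj: "inj_on \<mu> (carrier G)" and surj: "\<mu> ` carrier G = carrier G"
    using match by (auto simp: matchings_def bij_betw_def)
  have M: "M \<subseteq> carrier G" "finite M"
    using finite_group by (auto simp: M_def)
  \<comment> \<open>Translation and \<open>\<mu>\<close> are both injective, so both sets have
    \<open>card M\<close> elements.\<close>
  have shift: "M #> a = \<mu> ` M" if a: "a \<in> carrier G" and sub: "M #> a \<subseteq> \<mu> ` M" for a
  proof -
    have "M #> a = (\<lambda>g. g \<otimes> a) ` M"
      by (auto simp: r_coset_def)
    moreover have "inj_on (\<lambda>g. g \<otimes> a) M"
      using M(1) a by (intro inj_onI) (simp add: subset_iff)
    ultimately have "card (M #> a) = card M"
      by (simp add: card_image)
    moreover have "card (\<mu> ` M) = card M"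
      using inj M by (intro card_image) (auto intro: inj_on_subset)
    ultimately show ?thesis
      using sub M by (intro card_subset_eq) auto
  qed
  \<comment> \<open>If \<open>r < t g\<close>, a partner of index below \<open>r\<close> would let
    \<open>g\<close> and the woman \<open>g \<otimes> A ! r\<close> block. If
    \<open>r = t g\<close>, she is already matched to \<open>g\<close>.\<close>
  have partner: "\<exists>g'\<in>carrier G. \<mu> g' = g \<otimes> A ! r \<and> r \<le> t g'"
    if g: "g \<in> carrier G" "r \<le> t g" for g r
  proof -
    have r: "r < order G"
      using t g le_less_trans by blast
    then have "g \<otimes> A ! r \<in> \<mu> ` carrier G"
      using g surj by simp
    then obtain g' where g': "g' \<in> carrier G" "\<mu> g' = g \<otimes> A ! r"
      by (metis imageE)
    have "\<not> (t g' < r \<and> r < t g)"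
      using blocks_template_iff[OF match g(1) g'(1) t[OF g(1)] t[OF g'(1)] r]
        stable[of g "g \<otimes> A ! r"] val g g' r by simp
    moreover have "r \<le> t g'" if "t g = r"
    proof -
      have "\<mu> g' = \<mu> g"
        using val g g' that by simp
      then have "g' = g"
        using inj g g' by (auto dest: inj_onD)
      then show ?thesis
        using that by simp
    qed
    ultimately show ?thesis
      using g g' by (intro bexI[of _ g']) auto
  qed
  have "M #> A ! Suc s \<subseteq> \<mu> ` M"
  proof
    fix h assume "h \<in> M #> A ! Suc s"
    then obtain g where "g \<in> carrier G" "Suc s \<le> t g" "h = g \<otimes> A ! Suc s"
      by (auto simp: r_coset_def M_def)
    with partner[of g "Suc s"] obtain g' where "g' \<in> M" "\<mu> g' = h"
      by (auto simp: M_def)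
    then show "h \<in> \<mu> ` M"
      by blast
  qed
  moreover have "M #> A ! s \<subseteq> \<mu> ` M"
  proof
    fix h assume "h \<in> M #> A ! s"
    then obtain g where g: "g \<in> carrier G" "Suc s \<le> t g" and h: "h = g \<otimes> A ! s"
      by (auto simp: r_coset_def M_def)
    with partner[of g s] obtain g' where g': "g' \<in> carrier G" "\<mu> g' = h" "s \<le> t g'"
      by auto
    \<comment> \<open>Stability alone gives only \<open>s \<le> t g'\<close>. Equality would, after
      cancelling \<open>A ! s\<close>, identify \<open>g'\<close> with \<open>g\<close>, whose index
      exceeds \<open>s\<close>.\<close>
    have "t g' \<noteq> s"
    proof
      assume eq: "t g' = s"
      then have "g' \<otimes> A ! s = g \<otimes> A ! s"
        using val[OF g'(1)] g'(2) h by simp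
      then have "g' = g"
        using g g' s by simp
      with eq g show False by simp
    qed
    with g' show "h \<in> \<mu> ` M"
      by (auto simp: M_def)
  qed
  ultimately show ?thesis
    using shift[of "A ! s"] shift[of "A ! Suc s"] s by simp
qed

lemma prime_order_stable_canonical:
  assumes p: "prime (order G)" and \<mu>: "\<mu> \<in> Stab (template G A)"
  shows "\<exists>t<order G. \<mu> = canonical_matching G A t"
proof -
  have ext: "\<mu> \<in> extensional (carrier G)" and bij: "bij_betw \<mu> (carrier G) (carrier G)"
    using \<mu> by (auto simp: Stab_def matchings_def)
  have "\<exists>i<order G. \<mu> g = g \<otimes> A ! i" if "g \<in> carrier G" for g
    using ex_rank[OF that bij_betwE[OF bij, rule_format, OF that]] by blast
  then obtain t where t: "\<And>g. g \<in> carrier G \<Longrightarrow> t g < order G"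
    and val: "\<And>g. g \<in> carrier G \<Longrightarrow> \<mu> g = g \<otimes> A ! t g"
    by metis
  \<comment> \<open>Since \<open>g\<close> and \<open>h\<close> are arbitrary, this forces
    \<open>t\<close> to be constant. The superlevel set at height \<open>t h\<close> contains
    \<open>h\<close>; once it is the whole group, it contains \<open>g\<close>.\<close>
  have le: "t h \<le> t g" if g: "g \<in> carrier G" and h: "h \<in> carrier G" for g h
  proof (cases "t h")
    case (Suc s)
    define M where "M = {g \<in> carrier G. Suc s \<le> t g}"
    have s: "Suc s < order G" "s < order G"
      using t[OF h] Suc by simp_all
    \<comment> \<open>Translating by \<open>A ! s\<close> and back by the inverse of
      \<open>A ! Suc s\<close> fixes \<open>M\<close>; \<open>?c\<close> is nontrivial as the two
      entries differ.\<close>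
    let ?c = "A ! s \<otimes> inv (A ! Suc s)"
    have M: "M \<subseteq> carrier G" "h \<in> M"
      using h Suc by (auto simp: M_def)
    have "M #> ?c = (M #> A ! s) #> inv (A ! Suc s)"
      using M s by (simp add: coset_mult_assoc)
    also have "\<dots> = (M #> A ! Suc s) #> inv (A ! Suc s)"
      using stable_superlevel_shift[OF \<mu> t val s(1)] by (simp add: M_def)
    also have "\<dots> = M"
      using M s by (simp add: coset_mult_assoc)
    finally have "M #> ?c = M" .
    moreover have "?c \<noteq> \<one>"
    proof
      assume "?c = \<one>"
      then have "A ! s = A ! Suc s"
        using s by (simp add: inv_solve_right')
      then show False
        using s nth_ordering_eq_iff[of s "Suc s"] by simp
    qed
    ultimately have "M = carrier G"
      using M s by (intro prime_order_r_coset_fixed[OF p, of ?c]) auto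
    with g Suc show ?thesis
      by (auto simp: M_def)
  qed simp
  have "\<mu> = canonical_matching G A (t \<one>)"
  proof (rule extensionalityI[OF ext])
    show "canonical_matching G A (t \<one>) \<in> extensional (carrier G)"
      by (simp add: canonical_matching_def)
    fix g assume g: "g \<in> carrier G"
    then have "t g = t \<one>"
      using le[of g \<one>] le[of \<one> g] by simp
    with g val show "\<mu> g = canonical_matching G A (t \<one>) g"
      by (simp add: canonical_matching_def)
  qed
  then show ?thesis
    using t by blast
qed

section \<open>The set of stable matchings as a chain\<close>

lemma prime_order_Stab:
  assumes "prime (order G)"
  shows "Stab (template G A) = canonical_matching G A ` {..<order G}"
  using prime_order_stable_canonical[OF assms] canonical_matching_stable by blast

text \<open>Through the indices the order axioms become those of the naturals with the direction
  reversed: index 0 is the top.\<close>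

lemma prime_order_total_order:
  assumes "prime (order G)"
  shows "total_order (stable_lattice (template G A))"
  by unfold_locales
    (auto simp: stable_lattice_def prime_order_Stab[OF assms] men_dominates_canonical_iff)

end

theorem corollary5p10:
  fixes G :: "('a, 'b) monoid_scheme" and p :: nat
  assumes "group G" and "prime p" and "order G = p"
  shows "G \<cong> integer_mod_group p \<and>
    (\<forall>A. is_ranking (carrier G) A \<longrightarrow>
       Stab (template G A) = {canonical_matching G A t |t. t < p} \<and>
       card (Stab (template G A)) = p \<and>
       total_order (stable_lattice (template G A)) \<and>
       card (carrier (stable_lattice (template G A))) = p)"
proof (intro conjI allI impI)
  interpret group G by fact
  show "G \<cong> integer_mod_group p"
    using prime_order_iso_integer_mod_group assms by blast
  fix A assume "is_ranking (carrier G) A"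
  then interpret group_ordering G A
    by unfold_locales
  have p: "prime (order G)"
    using assms by simp
  show "Stab (template G A) = {canonical_matching G A t |t. t < p}"
    unfolding prime_order_Stab[OF p] using assms by auto
  show card: "card (Stab (template G A)) = p"
    unfolding prime_order_Stab[OF p] using assms card_image[OF inj_canonical_matching] by simp
  show "total_order (stable_lattice (template G A))"
    using prime_order_total_order[OF p] .
  show "card (carrier (stable_lattice (template G A))) = p"
    using card by (simp add: stable_lattice_def)
qed

end
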